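(* Let $n>m\ge 1$ and let $L_1,\dots,L_m\in\mathbb Z[x_1,\dots,x_n]$ be integer linear forms. Let $A\in\mathbb Z^{m\times n}$ be the matrix whose $i$-th row is the coefficient vector of $L_i$, and suppose the $m\times m$ minors of $A$ are coprime (their greatest common divisor is $1$). Then the polynomial $F(\mathbf x)=\prod_{i=1}^m L_i(\mathbf x)$ represents all integers. Furthermore, for $b\in\mathbb Z$ let $\mathbf b=(b,1,\dots,1)^\top\in\mathbb Z^m$ and let $\mu(A,b)$ be the maximum of the absolute values of the $m\times m$ minors of the augmented matrix $(A\ \mathbf b)\in\mathbb Z^{m\times(n+1)}$. Then there exists $\mathbf a\in\mathbb Z^n$ with $F(\mathbf a)=b$ and $|\mathbf a|\le\mu(A,b)$.
   Context: $F$ represents $b$ if $F(\mathbf a)=b$ for some $\mathbf a\in\mathbb Z^n$; $|\mathbf a|=\max_i|a_i|$. *)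

theory Defs
  imports "Jordan_Normal_Form.Determinant" "Jordan_Normal_Form.DL_Submatrix"
begin

text \<open>
  Integer points are vectors in \<open>carrier_vec n\<close>, and polynomials in \<open>n\<close> variables over the
  integers are treated as the functions they induce on these points.
  All indices start at 0.
\<close>

definition linear_form :: "int vec \<Rightarrow> int vec \<Rightarrow> int" where
  "linear_form c x = c \<bullet> x"

definition form_product :: "nat \<Rightarrow> (nat \<Rightarrow> int vec \<Rightarrow> int) \<Rightarrow> int vec \<Rightarrow> int" where
  "form_product m L x = (\<Prod>i<m. L i x)"

definition represents :: "nat \<Rightarrow> (int vec \<Rightarrow> int) \<Rightarrow> int \<Rightarrow> bool" where
  "represents n F b \<longleftrightarrow> (\<exists>a \<in> carrier_vec n. F a = b)"

text \<open>Meaningful only for vectors of positive dimension.\<close>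
definition max_norm :: "int vec \<Rightarrow> int" where
  "max_norm a = (MAX i \<in> {..<dim_vec a}. \<bar>a $ i\<bar>)"

text \<open>
  For an \<open>m\<close> by \<open>n\<close> matrix with \<open>m \<le> n\<close>, these are its \<open>m\<close> by \<open>m\<close> minors: \<open>J\<close> is the set of
  selected columns, which \<open>submatrix\<close> keeps in increasing order.
\<close>
definition maximal_minors :: "int mat \<Rightarrow> int set" where
  "maximal_minors A =
     {det (submatrix A UNIV J) | J. J \<subseteq> {..<dim_col A} \<and> card J = dim_row A}"

definition append_column :: "int mat \<Rightarrow> int vec \<Rightarrow> int mat" where
  "append_column A v =
     mat (dim_row A) (dim_col A + 1) (\<lambda>(i, j). if j < dim_col A then A $$ (i, j) else v $ i)"

definition target_vec :: "nat \<Rightarrow> int \<Rightarrow> int vec" where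
  "target_vec m b = vec m (\<lambda>i. if i = 0 then b else 1)"

definition mu :: "int mat \<Rightarrow> int \<Rightarrow> int" where
  "mu A b = Max (abs ` maximal_minors (append_column A (target_vec (dim_row A) b)))"

end

theory Submission
  imports Defs
begin

text \<open>
  It suffices to find a small integer solution of \<open>A x = b\<close> with \<open>b = (b, 1, \<dots>, 1)\<close>. For any set \<open>J\<close>
  of \<open>m\<close> columns, multiplying by the adjugate shows that \<open>det A\<^sub>J\<close> times any integer vector lies in
  the lattice spanned by the columns of \<open>A\<close>; the minors being coprime, this lattice is everything.
  Now choose \<open>J\<close> such that \<open>D = \<bar>det A\<^sub>J\<bar>\<close> is maximal, and among the solutions that are nonnegative
  off \<open>J\<close> take one whose coordinates off \<open>J\<close> have the least sum. The lattice spanned by \<open>A\<^sub>J\<close> has at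
  most \<open>D\<close> cosets, so if that sum were at least \<open>D\<close>, two partial sums of the chosen columns would be
  congruent and their difference could be moved into \<open>J\<close>. Hence the sum is at most \<open>D - 1\<close>, and
  Cramer's rule bounds each coordinate \<open>x\<^sub>j\<close> with \<open>j \<in> J\<close> by \<open>D \<bar>x\<^sub>j\<bar> \<le> \<mu> + (D - 1) D \<le> D \<mu>\<close>.
\<close>

section \<open>The lattice spanned by the columns\<close>

definition col_lattice :: "int mat \<Rightarrow> int vec set" where
  "col_lattice M = (\<lambda>u. M *\<^sub>v u) ` carrier_vec (dim_col M)"

lemma index_mult_mat_vec_sum:
  fixes A :: "int mat"
  assumes "A \<in> carrier_mat m n" "x \<in> carrier_vec n" "r < m"
  shows "(A *\<^sub>v x) $ r = (\<Sum>i<n. A $$ (r, i) * x $ i)"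
  using assms by (simp add: scalar_prod_def lessThan_atLeast0)

lemma col_lattice_add:
  assumes "v \<in> col_lattice M" "w \<in> col_lattice M"
  shows "v + w \<in> col_lattice M"
proof -
  obtain s t where "s \<in> carrier_vec (dim_col M)" "v = M *\<^sub>v s"
    "t \<in> carrier_vec (dim_col M)" "w = M *\<^sub>v t"
    using assms by (auto simp: col_lattice_def)
  then have "v + w = M *\<^sub>v (s + t)" "s + t \<in> carrier_vec (dim_col M)"
    by (auto simp: mult_add_distrib_mat_vec[of M "dim_row M" "dim_col M"])
  then show ?thesis by (simp add: col_lattice_def)
qed

lemma col_lattice_smult:
  assumes "v \<in> col_lattice M"
  shows "c \<cdot>\<^sub>v v \<in> col_lattice M"
proof -
  obtain s where "s \<in> carrier_vec (dim_col M)" "v = M *\<^sub>v s"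
    using assms by (auto simp: col_lattice_def)
  then have "c \<cdot>\<^sub>v v = M *\<^sub>v (c \<cdot>\<^sub>v s)" "c \<cdot>\<^sub>v s \<in> carrier_vec (dim_col M)"
    by (auto intro!: eq_vecI)
  then show ?thesis by (simp add: col_lattice_def)
qed

text \<open>Applied with \<open>E\<close> an elementary matrix: a column operation never enlarges
  the lattice, and this inclusion is what the reduction of the last row relies on.\<close>

lemma col_lattice_mult_subset:
  assumes "M \<in> carrier_mat m n" "E \<in> carrier_mat n k"
  shows "col_lattice (M * E) \<subseteq> col_lattice M"
proof
  fix v assume "v \<in> col_lattice (M * E)"
  then obtain u where "u \<in> carrier_vec k" "v = (M * E) *\<^sub>v u"
    using assms by (auto simp: col_lattice_def)
  then have "v = M *\<^sub>v (E *\<^sub>v u)" "E *\<^sub>v u \<in> carrier_vec n"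
    using assms by (auto simp: assoc_mult_mat_vec)
  then show "v \<in> col_lattice M" using assms by (auto simp: col_lattice_def)
qed

text \<open>The adjugate supplies the preimage \<open>adj_mat M *\<^sub>v v\<close>. Used both for
  solvability and for making weights nonnegative.\<close>

lemma det_smult_in_col_lattice:
  assumes "M \<in> carrier_mat m m" "v \<in> carrier_vec m"
  shows "det M \<cdot>\<^sub>v v \<in> col_lattice M"
proof -
  have adj: "adj_mat M \<in> carrier_mat m m" "M * adj_mat M = det M \<cdot>\<^sub>m 1\<^sub>m m"
    using adj_mat[OF assms(1)] by auto
  have "M *\<^sub>v (adj_mat M *\<^sub>v v) = (M * adj_mat M) *\<^sub>v v"
    by (rule assoc_mult_mat_vec[OF assms(1) adj(1) assms(2), symmetric])
  also have "\<dots> = det M \<cdot>\<^sub>v v" using assms adj by auto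
  finally have "det M \<cdot>\<^sub>v v = M *\<^sub>v (adj_mat M *\<^sub>v v)" ..
  then show ?thesis
    using assms adj by (auto simp: col_lattice_def)
qed

section \<open>The index of a full-rank lattice\<close>

text \<open>
  Existence of such an \<open>h\<close> says that the column lattice has at most \<open>\<bar>det M\<bar>\<close> cosets.
\<close>
definition coset_coloring :: "int mat \<Rightarrow> (int vec \<Rightarrow> nat) \<Rightarrow> bool" where
  "coset_coloring M h \<longleftrightarrow>
     (\<forall>v \<in> carrier_vec (dim_row M). h v < nat \<bar>det M\<bar>) \<and>
     (\<forall>v \<in> carrier_vec (dim_row M). \<forall>w \<in> carrier_vec (dim_row M).
        h v = h w \<longrightarrow> v - w \<in> col_lattice M)"

text \<open>Differences in the smaller lattice lie in the larger one, and the number of colours is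
  the same. A colouring found after column operations thus serves the original matrix.\<close>

lemma coset_coloring_transfer:
  assumes "coset_coloring M' h" "col_lattice M' \<subseteq> col_lattice M"
    and "\<bar>det M'\<bar> = \<bar>det M\<bar>" "dim_row M' = dim_row M"
  shows "coset_coloring M h"
  using assms unfolding coset_coloring_def by (auto; blast)

text \<open>When the last row is zero except for a corner entry d, a coset is labelled by two
  digits: the last coordinate modulo |d|, and the colour that the top-left block gives to what
  remains once the quotient is cleared with the last column.\<close>

lemma coset_coloring_bordered:
  assumes M: "M \<in> carrier_mat (Suc m) (Suc m)"
    and zero: "\<And>k. k < m \<Longrightarrow> M $$ (m, k) = 0"
    and nz: "M $$ (m, m) \<noteq> 0"
    and h': "coset_coloring (mat_delete M m m) h'"
  shows "\<exists>h. coset_coloring M h"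
proof -
  define N where "N = mat_delete M m m"
  define d where "d = M $$ (m, m)"
  have N: "N \<in> carrier_mat m m"
    using mat_delete_carrier[OF M] by (simp add: N_def)
  have N_index: "N $$ (i, j) = M $$ (i, j)" if "i < m" "j < m" for i j
    using that M by (simp add: N_def mat_delete_def)
  have det: "det M = d * det N"
  proof -
    have "det M = (\<Sum>j<Suc m. M $$ (m, j) * cofactor M m j)"
      by (rule laplace_expansion_row[OF M]) simp
    also have "\<dots> = d * cofactor M m m" using zero by (simp add: d_def)
    also have "cofactor M m m = det N" by (simp add: cofactor_def N_def)
    finally show ?thesis .
  qed
  \<comment> \<open>Dividing by |d| keeps the remainder nonnegative; the factor \<open>sgn d\<close>
    then restores the identity \<open>v $ m = d * q v + r v\<close>.\<close>
  define q where "q v = sgn d * (v $ m div \<bar>d\<bar>)" for v :: "int vec"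
  define r where "r v = v $ m mod \<bar>d\<bar>" for v :: "int vec"
  have dnz: "d \<noteq> 0" using nz by (simp add: d_def)
  have split: "v $ m = d * q v + r v" for v
  proof -
    have "d * q v = (d * sgn d) * (v $ m div \<bar>d\<bar>)" by (simp add: q_def)
    also have "d * sgn d = \<bar>d\<bar>" by (simp add: abs_sgn)
    finally show ?thesis by (simp add: r_def)
  qed
  have r: "0 \<le> r v" "r v < \<bar>d\<bar>" for v using dnz by (auto simp: r_def)
  define res where "res v = vec m (\<lambda>i. v $ i - q v * M $$ (i, m))" for v :: "int vec"
  \<comment> \<open>Mixed radix: the low digit, in base |d|, is the remainder and the high digit is
    the colour of \<open>res v\<close>, so both can be recovered from \<open>h v\<close>.\<close>
  define h where "h v = nat (r v) + nat \<bar>d\<bar> * h' (res v)" for v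
  have h'_less: "h' (res v) < nat \<bar>det N\<bar>" for v
    using h' N unfolding coset_coloring_def N_def[symmetric] by (simp add: res_def)
  have "h v < nat \<bar>det M\<bar>" for v
  proof -
    have "h v < nat \<bar>d\<bar> + nat \<bar>d\<bar> * h' (res v)" using r[of v] by (simp add: h_def)
    also have "\<dots> = nat \<bar>d\<bar> * Suc (h' (res v))" by simp
    also have "\<dots> \<le> nat \<bar>d\<bar> * nat \<bar>det N\<bar>" using h'_less[of v] by (intro mult_left_mono) auto
    also have "\<dots> = nat \<bar>det M\<bar>" by (simp add: det abs_mult nat_mult_distrib)
    finally show ?thesis .
  qed
  moreover have "v - w \<in> col_lattice M"
    if v: "v \<in> carrier_vec (Suc m)" and w: "w \<in> carrier_vec (Suc m)" and eq: "h v = h w" for v w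
  proof -
    have "nat (r v) < nat \<bar>d\<bar>" "nat (r w) < nat \<bar>d\<bar>" using r[of v] r[of w] by auto
    then have "nat (r v) = h v mod nat \<bar>d\<bar>" "nat (r w) = h w mod nat \<bar>d\<bar>"
      "h' (res v) = h v div nat \<bar>d\<bar>" "h' (res w) = h w div nat \<bar>d\<bar>"
      using dnz by (simp_all add: h_def)
    then have "nat (r v) = nat (r w)" and heq: "h' (res v) = h' (res w)"
      by (simp_all only: eq)
    then have req: "r v = r w" using r[of v] r[of w] by simp
    have "res v - res w \<in> col_lattice N"
      using h' heq N unfolding coset_coloring_def N_def[symmetric] by (simp add: res_def)
    then obtain u where u: "u \<in> carrier_vec m" and Nu: "res v - res w = N *\<^sub>v u"
      using N by (auto simp: col_lattice_def)
    \<comment> \<open>The last column was subtracted \<open>q v\<close> times from \<open>v\<close>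
      and \<open>q w\<close> times from \<open>w\<close>, which dictates its coefficient in
      \<open>v - w\<close>.\<close>
    define u' where "u' = vec (Suc m) (\<lambda>i. if i < m then u $ i else q v - q w)"
    have u': "u' \<in> carrier_vec (Suc m)" by (simp add: u'_def)
    have "v - w = M *\<^sub>v u'"
    proof (rule eq_vecI)
      fix i assume "i < dim_vec (M *\<^sub>v u')"
      then have i: "i < Suc m" using M by simp
      have Mu: "(M *\<^sub>v u') $ i = (\<Sum>k<m. M $$ (i, k) * u $ k) + M $$ (i, m) * (q v - q w)"
        by (subst index_mult_mat_vec_sum[OF M u' i]) (simp add: u'_def)
      show "(v - w) $ i = (M *\<^sub>v u') $ i"
      proof (cases "i < m")
        case True
        then have "(\<Sum>k<m. M $$ (i, k) * u $ k) = (N *\<^sub>v u) $ i"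
          by (subst index_mult_mat_vec_sum[OF N u True]) (simp add: N_index)
        also have "\<dots> = (res v - res w) $ i" by (simp add: Nu)
        also have "\<dots> = v $ i - w $ i - (q v - q w) * M $$ (i, m)"
          using True by (simp add: res_def algebra_simps)
        finally show ?thesis using True w by (simp add: Mu)
      next
        case False
        then have "i = m" using i by simp
        then show ?thesis using w split[of v] split[of w] req zero Mu
          by (simp add: d_def algebra_simps)
      qed
    qed (use M v w in auto)
    then show ?thesis using u' M by (auto simp: col_lattice_def)
  qed
  ultimately have "coset_coloring M h"
    using M unfolding coset_coloring_def by auto
  then show ?thesis by blast
qed

text \<open>Induction on the dimension, with a Euclidean algorithm on the last row inside: column
  operations that preserve the determinant up to sign leave one nonzero entry there and move it to
  the corner, where the bordered case applies.\<close>

lemma coset_coloring_exists: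
  assumes "M \<in> carrier_mat m m" "det M \<noteq> 0"
  shows "\<exists>h. coset_coloring M h"
  using assms
proof (induction m arbitrary: M)
  case 0
  have "v - w = 0\<^sub>v 0" if "v \<in> carrier_vec 0" "w \<in> carrier_vec 0" for v w :: "int vec"
    using that by (intro eq_vecI) auto
  moreover have "0\<^sub>v 0 \<in> col_lattice M"
    using 0 by (auto simp: col_lattice_def intro!: image_eqI[of _ _ "0\<^sub>v 0"])
  ultimately have "coset_coloring M (\<lambda>_. 0)"
    using 0 unfolding coset_coloring_def by auto
  then show ?case by blast
next
  case (Suc m)
  have bordered: "\<exists>h. coset_coloring K h"
    if K: "K \<in> carrier_mat (Suc m) (Suc m)" and det: "det K \<noteq> 0"
      and zero: "\<And>k. k < m \<Longrightarrow> K $$ (m, k) = 0" for K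
  proof -
    have "det K = (\<Sum>j<Suc m. K $$ (m, j) * cofactor K m j)"
      by (rule laplace_expansion_row[OF K]) simp
    also have "\<dots> = K $$ (m, m) * det (mat_delete K m m)"
      using zero by (simp add: cofactor_def)
    finally have nz: "K $$ (m, m) \<noteq> 0" "det (mat_delete K m m) \<noteq> 0" using det by auto
    have "mat_delete K m m \<in> carrier_mat m m" using mat_delete_carrier[OF K] by simp
    from Suc.IH[OF this nz(2)] obtain h' where "coset_coloring (mat_delete K m m) h'" ..
    from coset_coloring_bordered[OF K zero nz(1) this] show ?thesis .
  qed
  show ?case using Suc.prems
  proof (induction "\<Sum>k<Suc m. nat \<bar>M $$ (m, k)\<bar>" arbitrary: M rule: less_induct)
    case less
    note M = less.prems(1)
    show ?case
    proof (cases "\<exists>k l. k < Suc m \<and> l < Suc m \<and> k \<noteq> l \<and> M $$ (m, k) \<noteq> 0 \<and> M $$ (m, l) \<noteq> 0")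
      case True
      then obtain k l where kl: "k < Suc m" "l < Suc m" "k \<noteq> l" "M $$ (m, l) \<noteq> 0"
        and le: "\<bar>M $$ (m, l)\<bar> \<le> \<bar>M $$ (m, k)\<bar>"
        by (metis linear)
      \<comment> \<open>The value is 1 or -1, with the sign that moves the entry in column
        \<open>k\<close> towards zero by the size of the entry in column \<open>l\<close>; as the
        latter is no larger, nothing overshoots.\<close>
      define a where "a = - (sgn (M $$ (m, k)) * sgn (M $$ (m, l)))"
      define M' where "M' = addcol a k l M"
      have M': "M' \<in> carrier_mat (Suc m) (Suc m)" using M by (auto simp: M'_def)
      have det: "det M' = det M" using kl M by (simp add: M'_def det_addcol)
      have "M' = M * addrow_mat (Suc m) a l k"
        unfolding M'_def by (rule addcol_mat[OF M kl(2)])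
      then have sub: "col_lattice M' \<subseteq> col_lattice M"
        using col_lattice_mult_subset[OF M addrow_mat_carrier] by simp
      have smaller: "\<bar>a * y + x\<bar> < \<bar>x\<bar>"
        if "y \<noteq> 0" "\<bar>y\<bar> \<le> \<bar>x\<bar>" "a = - (sgn x * sgn y)" for x y a :: int
        using that by (auto simp: sgn_if abs_if split: if_splits)
      have at_k: "\<bar>M' $$ (m, k)\<bar> < \<bar>M $$ (m, k)\<bar>"
        using smaller[OF kl(4) le a_def] M kl by (simp add: M'_def)
      have off_k: "M' $$ (m, i) = M $$ (m, i)" if "i < Suc m" "i \<noteq> k" for i
        using that M by (simp add: M'_def)
      have "(\<Sum>i<Suc m. nat \<bar>M' $$ (m, i)\<bar>) < (\<Sum>i<Suc m. nat \<bar>M $$ (m, i)\<bar>)"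
      proof (rule sum_strict_mono_ex1)
        show "\<forall>i\<in>{..<Suc m}. nat \<bar>M' $$ (m, i)\<bar> \<le> nat \<bar>M $$ (m, i)\<bar>"
        proof
          fix i assume "i \<in> {..<Suc m}"
          then show "nat \<bar>M' $$ (m, i)\<bar> \<le> nat \<bar>M $$ (m, i)\<bar>"
            using at_k off_k by (cases "i = k") auto
        qed
        show "\<exists>i\<in>{..<Suc m}. nat \<bar>M' $$ (m, i)\<bar> < nat \<bar>M $$ (m, i)\<bar>"
          using at_k kl by (intro bexI[of _ k]) auto
      qed simp
      from less.hyps[OF this M'] less.prems(2) det obtain h where "coset_coloring M' h" by auto
      then have "coset_coloring M h"
        by (rule coset_coloring_transfer) (use sub det M M' in auto)
      then show ?thesis by blast
    next
      case False
      show ?thesis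
      proof (cases "\<exists>k<m. M $$ (m, k) \<noteq> 0")
        case True
        then obtain k where k: "k < m" "M $$ (m, k) \<noteq> 0" by auto
        define M' where "M' = swapcols k m M"
        have M': "M' \<in> carrier_mat (Suc m) (Suc m)" using M by (simp add: M'_def)
        have det: "det M' = - det M"
          unfolding M'_def by (rule det_swapcols[OF _ _ _ M]) (use k in auto)
        have "M' = M * swaprows_mat (Suc m) k m"
          unfolding M'_def by (rule swapcols_mat[OF M]) (use k in auto)
        then have sub: "col_lattice M' \<subseteq> col_lattice M"
          using col_lattice_mult_subset[OF M swaprows_mat_carrier] by simp
        have "M' $$ (m, i) = 0" if "i < m" for i
        proof (cases "i = k")
          case True
          \<comment> \<open>At most one entry of the last row is nonzero, and column
            \<open>k\<close> already holds it.\<close>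
          have "M $$ (m, m) = 0"
            using False k by (metis lessI less_SucI nat_neq_iff)
          then show ?thesis using True that M by (simp add: M'_def)
        next
          case neq: False
          have "M $$ (m, i) = 0"
            using False k that neq by (meson less_SucI)
          then show ?thesis using neq that M by (simp add: M'_def)
        qed
        from bordered[OF M' _ this] det less.prems(2) obtain h where "coset_coloring M' h" by auto
        then have "coset_coloring M h"
          by (rule coset_coloring_transfer) (use sub det M M' in auto)
        then show ?thesis by blast
      next
        case False
        then show ?thesis using bordered[OF M less.prems(2)] by auto
      qed
    qed
  qed
qed

section \<open>Short sums in the quotient group\<close>

text \<open>Starting from zero, a coordinate still below its cap \<open>x i\<close> is raised by one
  at each step. Monotonicity makes the difference of any two members of the chain again a selection
  within \<open>x\<close>.\<close>

lemma unit_step_chain: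
  fixes x :: "'a \<Rightarrow> nat"
  assumes "finite I" "s \<le> sum x I"
  shows "\<exists>f. (\<forall>t\<le>s. sum (f t) I = t \<and> (\<forall>i\<in>I. f t i \<le> x i)) \<and>
             (\<forall>t t'. t \<le> t' \<longrightarrow> t' \<le> s \<longrightarrow> (\<forall>i\<in>I. f t i \<le> f t' i))"
  using assms(2)
proof (induction s)
  case 0
  show ?case by (intro exI[of _ "\<lambda>_ _. 0"]) auto
next
  case (Suc s)
  then obtain f where f: "\<And>t. t \<le> s \<Longrightarrow> sum (f t) I = t" "\<And>t i. t \<le> s \<Longrightarrow> i \<in> I \<Longrightarrow> f t i \<le> x i"
    "\<And>t t' i. t \<le> t' \<Longrightarrow> t' \<le> s \<Longrightarrow> i \<in> I \<Longrightarrow> f t i \<le> f t' i" by fastforce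
  have "\<exists>i\<in>I. f s i < x i"
  proof (rule ccontr)
    assume "\<not> ?thesis"
    then have "sum x I \<le> sum (f s) I" by (intro sum_mono) (auto simp: not_less)
    then show False using f(1)[of s] Suc.prems by simp
  qed
  then obtain j where j: "j \<in> I" "f s j < x j" ..
  define g where "g = (f s)(j := Suc (f s j))"
  have "sum g I = Suc s"
    using j f(1)[of s] assms(1) by (simp add: g_def sum.remove[of I j])
  moreover have "g i \<le> x i" if "i \<in> I" for i
    using that j f(2)[of s i] by (simp add: g_def)
  moreover have "f t i \<le> g i" if "i \<in> I" "t \<le> s" for i t
    using f(3)[of t s i] that by (cases "i = j") (auto simp: g_def)
  ultimately show ?case using f
    by (intro exI[of _ "f(Suc s := g)"]) (auto simp: le_Suc_eq)
qed

text \<open>Pigeonhole: the chain of sizes 0 to |det M| has one member more than there are colours,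
  so two members fall in one coset, and their difference is the selection sought.\<close>

lemma subsum_in_col_lattice:
  fixes x :: "nat \<Rightarrow> nat"
  assumes M: "M \<in> carrier_mat m m" "det M \<noteq> 0"
    and I: "finite I" "nat \<bar>det M\<bar> \<le> sum x I"
  shows "\<exists>y. (\<forall>i\<in>I. y i \<le> x i) \<and> 0 < sum y I \<and>
             vec m (\<lambda>r. \<Sum>i\<in>I. A $$ (r, i) * int (y i)) \<in> col_lattice M"
proof -
  let ?D = "nat \<bar>det M\<bar>"
  obtain h where h: "coset_coloring M h" using coset_coloring_exists[OF M] ..
  obtain f where f: "\<And>t. t \<le> ?D \<Longrightarrow> sum (f t) I = t" "\<And>t i. t \<le> ?D \<Longrightarrow> i \<in> I \<Longrightarrow> f t i \<le> x i"
    "\<And>t t' i. t \<le> t' \<Longrightarrow> t' \<le> ?D \<Longrightarrow> i \<in> I \<Longrightarrow> f t i \<le> f t' i"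
    using unit_step_chain[OF I] by fastforce
  define g where "g t = vec m (\<lambda>r. \<Sum>i\<in>I. A $$ (r, i) * int (f t i))" for t
  have "(h \<circ> g) ` {..?D} \<subseteq> {..<?D}"
    using h M(1) by (auto simp: coset_coloring_def g_def)
  then have "card ((h \<circ> g) ` {..?D}) \<le> card {..<?D}" by (intro card_mono) auto
  then have "\<not> inj_on (h \<circ> g) {..?D}"
    by (intro pigeonhole) simp
  then obtain s t where st: "s < t" "t \<le> ?D" "h (g s) = h (g t)"
    unfolding inj_on_def by (metis atMost_iff comp_apply nat_neq_iff)
  \<comment> \<open>This subtraction of natural numbers is exact on \<open>I\<close> because the
    chain is monotone.\<close>
  define y where "y i = f t i - f s i" for i
  have le: "f s i \<le> f t i" if "i \<in> I" for i using f(3)[of s t i] st that by simp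
  have "sum y I = t - s"
  proof -
    have "sum y I = sum (f t) I - sum (f s) I"
      unfolding y_def by (rule sum_subtractf_nat) (use le in auto)
    then show ?thesis using f(1) st by simp
  qed
  moreover have "y i \<le> x i" if "i \<in> I" for i
    using f(2)[of t i] st that by (simp add: y_def)
  moreover have "vec m (\<lambda>r. \<Sum>i\<in>I. A $$ (r, i) * int (y i)) = g t - g s"
    using le by (intro eq_vecI)
      (auto simp: g_def y_def of_nat_diff sum_subtractf[symmetric] algebra_simps intro!: sum.cong)
  moreover have "g t - g s \<in> col_lattice M"
    using h M(1) st(3) by (auto simp: coset_coloring_def g_def)
  ultimately show ?thesis using st by (intro exI[of _ y]) auto
qed

section \<open>Maximal minors\<close>

lemma finite_maximal_minors: "finite (maximal_minors A)"
proof -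
  have "maximal_minors A \<subseteq> (\<lambda>J. det (submatrix A UNIV J)) ` Pow {..<dim_col A}"
    by (auto simp: maximal_minors_def)
  then show ?thesis by (rule finite_subset) simp
qed

lemma bij_betw_pick:
  assumes "J \<subseteq> {..<n}"
  shows "bij_betw (pick J) {..<card J} J"
proof -
  have fin: "finite J" using assms finite_subset by blast
  have "inj_on (pick J) {..<card J}"
    by (intro inj_onI) (metis lessThan_iff nat_neq_iff pick_mono_le)
  moreover have "pick J ` {..<card J} \<subseteq> J"
    by (auto intro: pick_in_set_le)
  ultimately show ?thesis
    using fin by (simp add: bij_betw_def card_image card_subset_eq)
qed

lemma submatrix_columns:
  assumes "A \<in> carrier_mat m n" "J \<subseteq> {..<n}" "card J = m"
  shows "submatrix A UNIV J = mat m m (\<lambda>(r, k). A $$ (r, pick J k))"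
proof -
  have "{j. j < n \<and> j \<in> J} = J" using assms(2) by auto
  then show ?thesis using assms by (simp add: submatrix_def pick_UNIV)
qed

text \<open>Putting a new column into slot \<open>k\<close> breaks the increasing order kept by
  \<open>submatrix\<close>; sorting the columns costs only a sign. This lets the determinants in
  Cramer's rule be compared with minors.\<close>

lemma abs_det_columns_in_minors:
  assumes A: "A \<in> carrier_mat m n"
    and f: "inj_on f {..<m}" "f ` {..<m} \<subseteq> {..<n}"
  shows "\<bar>det (mat m m (\<lambda>(r, k). A $$ (r, f k)))\<bar> \<in> abs ` maximal_minors A"
proof -
  define J where "J = f ` {..<m}"
  have J: "J \<subseteq> {..<n}" "card J = m" using f by (auto simp: J_def card_image)
  define M where "M = submatrix A UNIV J"
  have M_eq: "M = mat m m (\<lambda>(r, k). A $$ (r, pick J k))"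
    unfolding M_def by (rule submatrix_columns[OF A J])
  then have M: "M \<in> carrier_mat m m" by simp
  have pick: "bij_betw (pick J) {..<m} J" using bij_betw_pick[OF J(1)] J(2) by simp
  \<comment> \<open>\<open>s\<close> gives the position of \<open>f k\<close> in the increasing
    listing of \<open>J\<close>; it is the identity from \<open>m\<close> on, as
    \<open>permutes\<close> demands.\<close>
  define s where "s k = (if k < m then inv_into {..<m} (pick J) (f k) else k)" for k
  have "bij_betw f {..<m} J" using f by (simp add: J_def inj_on_imp_bij_betw)
  then have "bij_betw (inv_into {..<m} (pick J) \<circ> f) {..<m} {..<m}"
    using bij_betw_inv_into[OF pick] by (rule bij_betw_trans)
  then have s_bij: "bij_betw s {..<m} {..<m}"
    by (rule bij_betw_cong[THEN iffD1, rotated]) (simp add: s_def)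
  then have s: "s permutes {0..<m}"
    by (intro bij_imp_permutes) (auto simp: s_def lessThan_atLeast0)
  have s_less: "s k < m" if "k < m" for k using s_bij that by (auto dest: bij_betwE)
  have pick_s: "pick J (s k) = f k" if "k < m" for k
    using that bij_betw_inv_into_right[OF pick, of "f k"] by (simp add: s_def J_def)
  \<comment> \<open>Transposition turns the permutation of columns into one of rows, the form
    handled by \<open>det_permute_rows\<close>.\<close>
  have "mat m m (\<lambda>(r, k). A $$ (r, f k)) =
      transpose_mat (mat m m (\<lambda>(i, j). transpose_mat M $$ (s i, j)))"
    using s_less pick_s by (intro eq_matI) (auto simp: M_eq)
  then have "det (mat m m (\<lambda>(r, k). A $$ (r, f k))) =
      det (mat m m (\<lambda>(i, j). transpose_mat M $$ (s i, j)))"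
    by (simp add: det_transpose[of _ m])
  also have "\<dots> = signof s * det M"
    using det_permute_rows[OF _ s, of "transpose_mat M"] M by (simp add: det_transpose)
  finally have "\<bar>det (mat m m (\<lambda>(r, k). A $$ (r, f k)))\<bar> = \<bar>det M\<bar>"
    by (simp add: abs_mult sign_def)
  moreover have "det M \<in> maximal_minors A"
    using A J by (auto simp: maximal_minors_def M_def)
  ultimately show ?thesis by auto
qed

text \<open>The cofactors along column \<open>k\<close> do not see that column, so they are those of
  \<open>M\<close>. The formula exhibits linearity in \<open>v\<close>, which later splits the
  numerator in Cramer's rule.\<close>

lemma det_replace_col:
  assumes M: "M \<in> carrier_mat m m" and k: "k < m"
  shows "det (replace_col M v k) = (\<Sum>i<m. v $ i * cofactor M i k)"
proof -
  have R: "replace_col M v k \<in> carrier_mat m m" using M by (simp add: replace_col_def)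
  have "mat_delete (replace_col M v k) i k = mat_delete M i k" if "i < m" for i
    using M k that by (intro eq_matI) (auto simp: mat_delete_def replace_col_def)
  then show ?thesis
    using M k by (subst laplace_expansion_column[OF R k])
      (auto simp: cofactor_def replace_col_def intro!: sum.cong)
qed

section \<open>Solvability\<close>

lemma sum_split_pick:
  fixes F :: "nat \<Rightarrow> int"
  assumes "J \<subseteq> {..<n}"
  shows "(\<Sum>i<n. F i) = (\<Sum>k<card J. F (pick J k)) + (\<Sum>i\<in>{..<n} - J. F i)"
  using sum.reindex_bij_betw[OF bij_betw_pick[OF assms], of F]
    sum.subset_diff[OF assms, of F] by (simp add: add.commute)

text \<open>Assembles one integer point from coordinates on \<open>J\<close>, indexed by position,
  and coordinates off \<open>J\<close>, indexed by column. Used with \<open>z\<close> zero to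
  compare lattices and with small weights for the final solution.\<close>

lemma extend_from_columns:
  fixes A :: "int mat"
  assumes A: "A \<in> carrier_mat m n" and J: "J \<subseteq> {..<n}" "card J = m"
    and u: "u \<in> carrier_vec m"
  obtains x where "x \<in> carrier_vec n" "\<And>k. k < m \<Longrightarrow> x $ pick J k = u $ k"
    "\<And>i. i < n \<Longrightarrow> i \<notin> J \<Longrightarrow> x $ i = z i"
    "A *\<^sub>v x = submatrix A UNIV J *\<^sub>v u + vec m (\<lambda>r. \<Sum>i\<in>{..<n} - J. A $$ (r, i) * z i)"
proof -
  note pick = bij_betw_pick[OF J(1), unfolded J(2)]
  define x where "x = vec n (\<lambda>i. if i \<in> J then u $ inv_into {..<m} (pick J) i else z i)"
  have x: "x \<in> carrier_vec n" by (simp add: x_def)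
  have on: "x $ pick J k = u $ k" if "k < m" for k
  proof -
    have "pick J k \<in> J" "pick J k < n" using pick that J(1) by (auto dest: bij_betwE)
    then show ?thesis
      using that bij_betw_inv_into_left[OF pick, of k] by (simp add: x_def)
  qed
  have off: "x $ i = z i" if "i < n" "i \<notin> J" for i using that by (simp add: x_def)
  let ?M = "submatrix A UNIV J"
  have M_eq: "?M = mat m m (\<lambda>(r, k). A $$ (r, pick J k))" by (rule submatrix_columns[OF A J])
  then have M: "?M \<in> carrier_mat m m" by simp
  have "A *\<^sub>v x = ?M *\<^sub>v u + vec m (\<lambda>r. \<Sum>i\<in>{..<n} - J. A $$ (r, i) * z i)"
  proof (rule eq_vecI)
    fix r assume "r < dim_vec (?M *\<^sub>v u + vec m (\<lambda>r. \<Sum>i\<in>{..<n} - J. A $$ (r, i) * z i))"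
    then have r: "r < m" by simp
    have "(A *\<^sub>v x) $ r = (\<Sum>k<m. A $$ (r, pick J k) * x $ pick J k) +
        (\<Sum>i\<in>{..<n} - J. A $$ (r, i) * x $ i)"
      using sum_split_pick[OF J(1)] J(2) by (simp add: index_mult_mat_vec_sum[OF A x r])
    also have "(\<Sum>k<m. A $$ (r, pick J k) * x $ pick J k) = (?M *\<^sub>v u) $ r"
      by (simp add: index_mult_mat_vec_sum[OF M u r]) (simp add: M_eq r on)
    also have "(\<Sum>i\<in>{..<n} - J. A $$ (r, i) * x $ i) = (\<Sum>i\<in>{..<n} - J. A $$ (r, i) * z i)"
      by (intro sum.cong) (auto simp: off)
    finally show "(A *\<^sub>v x) $ r =
        (?M *\<^sub>v u + vec m (\<lambda>r. \<Sum>i\<in>{..<n} - J. A $$ (r, i) * z i)) $ r"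
      using r M by simp
  qed (use A M in auto)
  with x on off show thesis by (rule that)
qed

lemma col_lattice_submatrix_subset:
  assumes A: "A \<in> carrier_mat m n" and J: "J \<subseteq> {..<n}" "card J = m"
  shows "col_lattice (submatrix A UNIV J) \<subseteq> col_lattice A"
proof
  fix v assume v: "v \<in> col_lattice (submatrix A UNIV J)"
  have M: "submatrix A UNIV J \<in> carrier_mat m m" by (simp add: submatrix_columns[OF A J])
  obtain u where u: "u \<in> carrier_vec m" "v = submatrix A UNIV J *\<^sub>v u"
    using v M by (auto simp: col_lattice_def)
  obtain x where x: "x \<in> carrier_vec n"
    "A *\<^sub>v x = v + vec m (\<lambda>r. \<Sum>i\<in>{..<n} - J. A $$ (r, i) * 0)"
    using extend_from_columns[OF A J u(1), of "\<lambda>_. 0"] u(2) by metis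
  have "A *\<^sub>v x = v" using x(2) u M by (intro eq_vecI) auto
  then show "v \<in> col_lattice A" using A x(1) by (auto simp: col_lattice_def)
qed

text \<open>The closure assumptions make \<open>K\<close> an ideal, so Bezout coefficients keep each
  successive gcd inside it.\<close>

lemma Gcd_closed:
  fixes S K :: "int set"
  assumes "finite S" "S \<subseteq> K" "0 \<in> K"
    and "\<And>a b. a \<in> K \<Longrightarrow> b \<in> K \<Longrightarrow> a + b \<in> K" "\<And>a c. a \<in> K \<Longrightarrow> c * a \<in> K"
  shows "Gcd S \<in> K"
  using assms(1,2)
proof (induction S rule: finite_induct)
  case empty
  then show ?case using assms(3) by simp
next
  case (insert a S)
  obtain u v where "u * a + v * Gcd S = gcd a (Gcd S)" using bezout_int by blast
  moreover have "u * a + v * Gcd S \<in> K" using insert assms(4,5) by auto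
  ultimately show ?case by simp
qed

text \<open>For fixed \<open>v\<close>, the integers \<open>c\<close> with
  \<open>c \<cdot>\<^sub>v v\<close> in the lattice form an ideal. It contains all maximal minors by
  the adjugate identity, hence their gcd 1.\<close>

lemma carrier_subset_col_lattice:
  assumes A: "A \<in> carrier_mat m n" and "Gcd (maximal_minors A) = 1"
  shows "carrier_vec m \<subseteq> col_lattice A"
proof
  fix v :: "int vec" assume v: "v \<in> carrier_vec m"
  have "Gcd (maximal_minors A) \<in> {c. c \<cdot>\<^sub>v v \<in> col_lattice A}"
  proof (rule Gcd_closed[OF finite_maximal_minors])
    show "maximal_minors A \<subseteq> {c. c \<cdot>\<^sub>v v \<in> col_lattice A}"
    proof
      fix c assume "c \<in> maximal_minors A"
      then obtain J where J: "J \<subseteq> {..<n}" "card J = m" and c: "c = det (submatrix A UNIV J)"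
        using A by (auto simp: maximal_minors_def)
      have "submatrix A UNIV J \<in> carrier_mat m m" by (simp add: submatrix_columns[OF A J])
      from det_smult_in_col_lattice[OF this v] col_lattice_submatrix_subset[OF A J]
      show "c \<in> {c. c \<cdot>\<^sub>v v \<in> col_lattice A}" by (auto simp: c)
    qed
    have "0 \<cdot>\<^sub>v v = A *\<^sub>v 0\<^sub>v n" using A v by (intro eq_vecI) auto
    then show "0 \<in> {c. c \<cdot>\<^sub>v v \<in> col_lattice A}" using A by (auto simp: col_lattice_def)
    show "a + b \<in> {c. c \<cdot>\<^sub>v v \<in> col_lattice A}"
      if "a \<in> {c. c \<cdot>\<^sub>v v \<in> col_lattice A}" "b \<in> {c. c \<cdot>\<^sub>v v \<in> col_lattice A}" for a b
      using that col_lattice_add by (simp add: add_smult_distrib_vec)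
    show "c * a \<in> {c. c \<cdot>\<^sub>v v \<in> col_lattice A}" if "a \<in> {c. c \<cdot>\<^sub>v v \<in> col_lattice A}" for a c
      using that col_lattice_smult[of "a \<cdot>\<^sub>v v" A c] by (simp add: smult_smult_assoc)
  qed
  then show "v \<in> col_lattice A" using assms(2) by simp
qed

section \<open>Small solutions\<close>

text \<open>Only the weights off \<open>J\<close> are minimised: they are feasible when what they
  leave of \<open>b\<close> lies in the lattice of \<open>M\<close>, and \<open>u\<close> is read
  off at the end.\<close>

lemma small_feasible_weights:
  fixes A :: "int mat"
  assumes A: "A \<in> carrier_mat m n" and J: "J \<subseteq> {..<n}" "card J = m"
    and M_def: "M = submatrix A UNIV J" and det: "det M \<noteq> 0"
    and b: "b \<in> col_lattice A"
  obtains z :: "nat \<Rightarrow> nat" and u where "u \<in> carrier_vec m"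
    "b = M *\<^sub>v u + vec m (\<lambda>r. \<Sum>i\<in>{..<n} - J. A $$ (r, i) * int (z i))"
    "(\<Sum>i\<in>{..<n} - J. z i) < nat \<bar>det M\<bar>"
proof -
  let ?N = "{..<n} - J" and ?D = "nat \<bar>det M\<bar>"
  define S where "S z = vec m (\<lambda>r. \<Sum>i\<in>?N. A $$ (r, i) * z i)" for z
  have S: "S z \<in> carrier_vec m" for z by (simp add: S_def)
  have dim_S: "dim_vec (S z) = m" for z by (simp add: S_def)
  have S_add: "S (\<lambda>i. y i + z i) = S y + S z" for y z
    by (intro eq_vecI) (auto simp: S_def sum.distrib algebra_simps)
  have M_eq: "M = mat m m (\<lambda>(r, k). A $$ (r, pick J k))"
    unfolding M_def by (rule submatrix_columns[OF A J])
  then have M: "M \<in> carrier_mat m m" by simp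
  \<comment> \<open>Weights can therefore be shifted by multiples of \<open>det M\<close> without
    losing feasibility.\<close>
  have det_S: "S (\<lambda>i. det M * z i) \<in> col_lattice M" for z
  proof -
    have "S (\<lambda>i. det M * z i) = det M \<cdot>\<^sub>v S z"
      by (intro eq_vecI) (auto simp: S_def sum_distrib_left algebra_simps)
    then show ?thesis using det_smult_in_col_lattice[OF M S] by simp
  qed
  define P where "P z \<longleftrightarrow> b - S (\<lambda>i. int (z i)) \<in> col_lattice M" for z
  have b_carrier: "b \<in> carrier_vec m" using b A by (auto simp: col_lattice_def)
  obtain x where x: "x \<in> carrier_vec n" "b = A *\<^sub>v x"
    using b A by (auto simp: col_lattice_def)
  \<comment> \<open>Reducing an arbitrary integer solution modulo |det M| gives nonnegative feasible
    weights, so a minimum exists.\<close>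
  define z0 where "z0 i = nat (x $ i mod \<bar>det M\<bar>)" for i
  have "P z0"
  proof -
    define y where "y = vec m (\<lambda>k. x $ pick J k)"
    define c where "c i = sgn (det M) * (x $ i div \<bar>det M\<bar>)" for i
    have y: "y \<in> carrier_vec m" by (simp add: y_def)
    have x_split: "x $ i = int (z0 i) + det M * c i" for i
    proof -
      have "det M * c i = (det M * sgn (det M)) * (x $ i div \<bar>det M\<bar>)" by (simp add: c_def)
      also have "det M * sgn (det M) = \<bar>det M\<bar>" by (simp add: abs_sgn)
      finally show ?thesis using det by (simp add: z0_def)
    qed
    have "b = M *\<^sub>v y + S (\<lambda>i. x $ i)"
    proof (rule eq_vecI)
      fix r assume "r < dim_vec (M *\<^sub>v y + S (\<lambda>i. x $ i))"
      then have r: "r < m" by (simp add: dim_S)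
      have "(M *\<^sub>v y) $ r = (\<Sum>k<m. A $$ (r, pick J k) * x $ pick J k)"
        by (simp add: index_mult_mat_vec_sum[OF M y r]) (simp add: M_eq r y_def)
      then show "b $ r = (M *\<^sub>v y + S (\<lambda>i. x $ i)) $ r"
        using sum_split_pick[OF J(1), of "\<lambda>i. A $$ (r, i) * x $ i"] J(2) r M S[of "\<lambda>i. x $ i"]
        by (simp add: x(2) index_mult_mat_vec_sum[OF A x(1) r] S_def del: index_mult_mat_vec)
    qed (use b_carrier M in \<open>auto simp: dim_S\<close>)
    also have "S (\<lambda>i. x $ i) = S (\<lambda>i. int (z0 i)) + S (\<lambda>i. det M * c i)"
      unfolding x_split by (rule S_add)
    finally have "b - S (\<lambda>i. int (z0 i)) = M *\<^sub>v y + S (\<lambda>i. det M * c i)"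
      using M y by (intro eq_vecI) (auto simp: S_def)
    moreover have "M *\<^sub>v y \<in> col_lattice M" using M y by (auto simp: col_lattice_def)
    ultimately show ?thesis using col_lattice_add det_S by (simp add: P_def)
  qed
  then obtain z where z: "P z" and least: "\<And>y. P y \<Longrightarrow> sum z ?N \<le> sum y ?N"
    using ex_has_least_nat[of P z0 "\<lambda>z. sum z ?N"] by blast
  have "sum z ?N < ?D"
  proof (rule ccontr)
    assume "\<not> sum z ?N < ?D"
    then obtain y where y: "\<And>i. i \<in> ?N \<Longrightarrow> y i \<le> z i" "0 < sum y ?N"
      "S (\<lambda>i. int (y i)) \<in> col_lattice M"
      using subsum_in_col_lattice[OF M det, of ?N z A] by (auto simp: S_def)
    \<comment> \<open>Removing \<open>y\<close> changes the remainder by a lattice vector, so the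
      smaller weights stay feasible, against minimality.\<close>
    have "b - S (\<lambda>i. int (z i - y i)) = (b - S (\<lambda>i. int (z i))) + S (\<lambda>i. int (y i))"
    proof (rule eq_vecI)
      fix r assume "r < dim_vec ((b - S (\<lambda>i. int (z i))) + S (\<lambda>i. int (y i)))"
      then have r: "r < m" by (simp add: S_def)
      have "(\<Sum>i\<in>?N. A $$ (r, i) * int (z i - y i)) =
          (\<Sum>i\<in>?N. A $$ (r, i) * int (z i)) - (\<Sum>i\<in>?N. A $$ (r, i) * int (y i))"
        unfolding sum_subtractf[symmetric]
        using y(1) by (intro sum.cong) (auto simp: of_nat_diff algebra_simps)
      then show "(b - S (\<lambda>i. int (z i - y i))) $ r =
          ((b - S (\<lambda>i. int (z i))) + S (\<lambda>i. int (y i))) $ r"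
        using r b_carrier by (simp add: S_def)
    qed (simp add: S_def)
    then have "P (\<lambda>i. z i - y i)"
      using z y(3) col_lattice_add by (simp add: P_def)
    then have "sum z ?N \<le> sum (\<lambda>i. z i - y i) ?N" by (rule least)
    also have "\<dots> = sum z ?N - sum y ?N" by (rule sum_subtractf_nat) (use y in auto)
    finally have "sum z ?N - sum y ?N \<ge> sum z ?N" .
    moreover have "sum y ?N \<le> sum z ?N" by (rule sum_mono) (use y in auto)
    ultimately show False using y(2) by simp
  qed
  moreover obtain u where u: "u \<in> carrier_vec m" "b - S (\<lambda>i. int (z i)) = M *\<^sub>v u"
    using z M by (auto simp: P_def col_lattice_def)
  moreover have "b = M *\<^sub>v u + S (\<lambda>i. int (z i))"
    unfolding u(2)[symmetric] using b_carrier by (intro eq_vecI) (auto simp: S_def)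
  ultimately show thesis using that by (simp add: S_def)
qed

text \<open>In Cramer's rule for \<open>u\<close>, the numerator coming from \<open>b\<close> is up
  to sign a minor of the augmented matrix, and the one from a column off \<open>J\<close> is a minor
  of \<open>A\<close>, hence at most |det M| by the choice of \<open>J\<close>.\<close>

lemma small_solution:
  fixes A :: "int mat"
  assumes A: "A \<in> carrier_mat m n" and b: "b \<in> col_lattice A"
    and J: "J \<subseteq> {..<n}" "card J = m"
    and M_def: "M = submatrix A UNIV J" and det: "det M \<noteq> 0"
    and max: "\<And>d. d \<in> maximal_minors A \<Longrightarrow> \<bar>d\<bar> \<le> \<bar>det M\<bar>"
    and Y: "\<And>d. d \<in> maximal_minors (append_column A b) \<Longrightarrow> \<bar>d\<bar> \<le> Y"
  shows "\<exists>x \<in> carrier_vec n. A *\<^sub>v x = b \<and> (\<forall>i<n. \<bar>x $ i\<bar> \<le> Y)"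
proof -
  let ?N = "{..<n} - J" and ?D = "\<bar>det M\<bar>"
  have M_eq: "M = mat m m (\<lambda>(r, k). A $$ (r, pick J k))"
    unfolding M_def by (rule submatrix_columns[OF A J])
  then have M: "M \<in> carrier_mat m m" by simp
  note pick = bij_betw_pick[OF J(1), unfolded J(2)]
  have pick_in: "pick J k \<in> J" if "k < m" for k using pick that by (auto dest: bij_betwE)
  have pick_inj: "inj_on (pick J) {..<m}" using pick by (simp add: bij_betw_def)
  have inj: "inj_on ((pick J)(k := j)) {..<m}" if "j \<notin> J" for k j
    using pick_inj pick_in that by (auto simp: inj_on_def)
  let ?B = "append_column A b"
  have B: "?B \<in> carrier_mat m (n + 1)" using A by (simp add: append_column_def)
  have B_old: "?B $$ (r, i) = A $$ (r, i)" if "r < m" "i < n" for r i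
    using that A by (simp add: append_column_def)
  have B_new: "?B $$ (r, n) = b $ r" if "r < m" for r
    using that A by (simp add: append_column_def)
  have pick_less: "pick J k < n" if "k < m" for k using pick_in[OF that] J(1) by auto
  \<comment> \<open>Selecting only old columns shows that \<open>det M\<close> is, up to sign, a
    minor of the augmented matrix.\<close>
  have "\<bar>det (mat m m (\<lambda>(r, k). ?B $$ (r, pick J k)))\<bar> \<in> abs ` maximal_minors ?B"
    by (rule abs_det_columns_in_minors[OF B pick_inj]) (use pick_less in \<open>auto simp: less_SucI\<close>)
  moreover have "mat m m (\<lambda>(r, k). ?B $$ (r, pick J k)) = M"
    by (intro eq_matI) (auto simp: M_eq B_old pick_less)
  ultimately have D_le: "?D \<le> Y" using Y by auto
  have det_b: "\<bar>det (replace_col M b k)\<bar> \<le> Y" if k: "k < m" for k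
  proof -
    have "n \<notin> J" using J(1) by auto
    have "replace_col M b k = mat m m (\<lambda>(r, j). ?B $$ (r, ((pick J)(k := n)) j))"
      by (intro eq_matI) (auto simp: M_eq replace_col_def B_old B_new pick_less)
    moreover have "\<bar>det (mat m m (\<lambda>(r, j). ?B $$ (r, ((pick J)(k := n)) j)))\<bar>
        \<in> abs ` maximal_minors ?B"
      by (rule abs_det_columns_in_minors[OF B inj[OF \<open>n \<notin> J\<close>]])
        (use pick_less in \<open>auto simp: less_SucI\<close>)
    ultimately show ?thesis using Y by auto
  qed
  have det_A: "\<bar>det (replace_col M (col A i) k)\<bar> \<le> ?D" if k: "k < m" and i: "i \<in> ?N" for k i
  proof -
    have "replace_col M (col A i) k = mat m m (\<lambda>(r, j). A $$ (r, ((pick J)(k := i)) j))"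
      using A i by (intro eq_matI) (auto simp: M_eq replace_col_def)
    moreover have "\<bar>det (mat m m (\<lambda>(r, j). A $$ (r, ((pick J)(k := i)) j)))\<bar>
        \<in> abs ` maximal_minors A"
      by (rule abs_det_columns_in_minors[OF A inj]) (use pick_less i in auto)
    ultimately show ?thesis using max by auto
  qed
  obtain z :: "nat \<Rightarrow> nat" and u where u: "u \<in> carrier_vec m"
    and b_eq: "b = M *\<^sub>v u + vec m (\<lambda>r. \<Sum>i\<in>?N. A $$ (r, i) * int (z i))"
    and z: "(\<Sum>i\<in>?N. z i) < nat ?D"
    using small_feasible_weights[OF A J M_def det b] by blast
  \<comment> \<open>The \<open>- 1\<close> from the strict inequality is essential: it leaves room
    for the one term of size \<open>Y\<close> contributed by \<open>b\<close>.\<close>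
  have z_sum: "(\<Sum>i\<in>?N. int (z i)) \<le> ?D - 1"
    using z unfolding of_nat_sum[symmetric] by linarith
  have u_bound: "\<bar>u $ k\<bar> \<le> Y" if k: "k < m" for k
  proof -
    have "u $ k * det M = det (replace_col M (M *\<^sub>v u) k)"
      by (rule cramer_lemma_mat[OF M u k, symmetric])
    also have "\<dots> = (\<Sum>r<m. (M *\<^sub>v u) $ r * cofactor M r k)"
      by (rule det_replace_col[OF M k])
    \<comment> \<open>\<open>M *\<^sub>v u\<close> is \<open>b\<close> minus the weighted columns
      off \<open>J\<close>; linearity then yields one determinant for \<open>b\<close> and one for
      each such column.\<close>
    also have "\<dots> = (\<Sum>r<m. (b $ r - (\<Sum>i\<in>?N. A $$ (r, i) * int (z i))) * cofactor M r k)"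
    proof (intro sum.cong refl)
      fix r assume r: "r \<in> {..<m}"
      have "b $ r = (M *\<^sub>v u) $ r + (\<Sum>i\<in>?N. A $$ (r, i) * int (z i))"
        by (subst b_eq) (use r M in simp)
      then show "(M *\<^sub>v u) $ r * cofactor M r k =
          (b $ r - (\<Sum>i\<in>?N. A $$ (r, i) * int (z i))) * cofactor M r k" by simp
    qed
    also have "\<dots> = (\<Sum>r<m. b $ r * cofactor M r k) -
        (\<Sum>r<m. \<Sum>i\<in>?N. int (z i) * (A $$ (r, i) * cofactor M r k))"
      unfolding sum_subtractf[symmetric]
      by (intro sum.cong refl) (simp add: algebra_simps sum_distrib_left)
    also have "(\<Sum>r<m. \<Sum>i\<in>?N. int (z i) * (A $$ (r, i) * cofactor M r k)) =
        (\<Sum>i\<in>?N. int (z i) * (\<Sum>r<m. A $$ (r, i) * cofactor M r k))"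
      by (subst sum.swap) (simp add: sum_distrib_left)
    also have "\<dots> = (\<Sum>i\<in>?N. int (z i) * det (replace_col M (col A i) k))"
      using A by (intro sum.cong refl) (simp add: det_replace_col[OF M k])
    finally have cramer: "u $ k * det M = det (replace_col M b k) -
        (\<Sum>i\<in>?N. int (z i) * det (replace_col M (col A i) k))"
      by (simp add: det_replace_col[OF M k])
    have "\<bar>\<Sum>i\<in>?N. int (z i) * det (replace_col M (col A i) k)\<bar> \<le>
        (\<Sum>i\<in>?N. \<bar>int (z i) * det (replace_col M (col A i) k)\<bar>)" by (rule sum_abs)
    also have "\<dots> \<le> (\<Sum>i\<in>?N. int (z i) * ?D)"
      using det_A[OF k] by (intro sum_mono) (auto simp: abs_mult intro!: mult_left_mono)
    also have "\<dots> = (\<Sum>i\<in>?N. int (z i)) * ?D" by (simp add: sum_distrib_right)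
    also have "\<dots> \<le> (?D - 1) * ?D" using z_sum by (intro mult_right_mono) auto
    finally have "\<bar>u $ k\<bar> * ?D \<le> Y + (?D - 1) * ?D"
      using det_b[OF k] unfolding abs_mult[symmetric] cramer by linarith
    \<comment> \<open>The factor \<open>?D - 1\<close> is nonnegative since \<open>det M\<close> is
      a nonzero integer.\<close>
    also have "\<dots> \<le> Y + (?D - 1) * Y" using D_le det by (intro add_left_mono mult_left_mono) auto
    also have "\<dots> = Y * ?D" by (simp add: algebra_simps)
    finally show ?thesis using det by simp
  qed
  obtain x where x: "x \<in> carrier_vec n" "\<And>k. k < m \<Longrightarrow> x $ pick J k = u $ k"
    "\<And>i. i < n \<Longrightarrow> i \<notin> J \<Longrightarrow> x $ i = int (z i)" "A *\<^sub>v x = b"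
    using extend_from_columns[OF A J u, of "\<lambda>i. int (z i)"] b_eq unfolding M_def by metis
  have "\<bar>x $ i\<bar> \<le> Y" if i: "i < n" for i
  proof (cases "i \<in> J")
    case True
    then obtain k where "k < m" "i = pick J k" using pick by (auto simp: bij_betw_def)
    then show ?thesis using x(2) u_bound by simp
  next
    case False
    \<comment> \<open>A single nonnegative weight is at most the total, hence below |det M|, which
      is at most \<open>Y\<close>.\<close>
    then have "int (z i) \<le> (\<Sum>i\<in>?N. int (z i))" using i by (intro member_le_sum) auto
    then show ?thesis using x(3)[OF i False] z_sum D_le by simp
  qed
  with x show ?thesis by blast
qed

theorem theorem6:
  fixes m n :: nat and L :: "nat \<Rightarrow> int vec \<Rightarrow> int" and A :: "int mat"
  assumes "1 \<le> m" and "m < n"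
    and "A \<in> carrier_mat m n"
    and "\<And>i. i < m \<Longrightarrow> L i = linear_form (row A i)"
    and "Gcd (maximal_minors A) = 1"
  shows "(\<forall>b. represents n (form_product m L) b) \<and>
         (\<forall>b. \<exists>a \<in> carrier_vec n. form_product m L a = b \<and> max_norm a \<le> mu A b)"
proof -
  note A = assms(3)
  have ne: "maximal_minors A \<noteq> {}" using assms(5) by auto
  have "Max (abs ` maximal_minors A) \<in> abs ` maximal_minors A"
    using ne finite_maximal_minors by (intro Max_in) auto
  then obtain J where J: "J \<subseteq> {..<n}" "card J = m"
    and D: "Max (abs ` maximal_minors A) = \<bar>det (submatrix A UNIV J)\<bar>"
    using A by (auto simp: maximal_minors_def)
  define M where "M = submatrix A UNIV J"
  have max: "\<bar>d\<bar> \<le> \<bar>det M\<bar>" if "d \<in> maximal_minors A" for d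
    unfolding M_def D[symmetric] using that finite_maximal_minors by (intro Max_ge) auto
  \<comment> \<open>If the largest minor vanished, all would, and their gcd would be 0.\<close>
  have det: "det M \<noteq> 0"
  proof
    assume "det M = 0"
    then have "maximal_minors A \<subseteq> {0}" using max by auto
    then have "Gcd (maximal_minors A) = 0" by (auto simp: Gcd_0_iff)
    then show False using assms(5) by simp
  qed
  have main: "\<exists>a \<in> carrier_vec n. form_product m L a = b \<and> max_norm a \<le> mu A b" for b
  proof -
    let ?b = "target_vec m b"
    have "?b \<in> col_lattice A"
      using carrier_subset_col_lattice[OF A assms(5)] by (auto simp: target_vec_def)
    moreover have "\<bar>d\<bar> \<le> mu A b" if "d \<in> maximal_minors (append_column A ?b)" for d
      unfolding mu_def using that A finite_maximal_minors by (intro Max_ge) auto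
    ultimately obtain a where a: "a \<in> carrier_vec n" "A *\<^sub>v a = ?b"
      and bound: "\<And>i. i < n \<Longrightarrow> \<bar>a $ i\<bar> \<le> mu A b"
      using small_solution[OF A _ J M_def det max] by blast
    have "L i a = (if i = 0 then b else 1)" if "i < m" for i
    proof -
      have "L i a = (A *\<^sub>v a) $ i" using that A assms(4) by (simp add: linear_form_def)
      then show ?thesis using that by (simp add: a(2) target_vec_def)
    qed
    then have "form_product m L a = (\<Prod>i<m. if i = 0 then b else 1)"
      by (simp add: form_product_def)
    \<comment> \<open>\<open>1 \<le> m\<close> ensures that the factor with index 0, the one equal
      to \<open>b\<close>, occurs.\<close>
    also have "\<dots> = b" using assms(1) by (simp add: prod.delta)
    finally have "form_product m L a = b" .
    \<comment> \<open>\<open>m < n\<close> makes the index set nonempty, so the maximum is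
      meaningful.\<close>
    moreover have "max_norm a \<le> mu A b"
      unfolding max_norm_def using a(1) bound assms(2) by (subst Max_le_iff) auto
    ultimately show ?thesis using a(1) by blast
  qed
  then show ?thesis unfolding represents_def by blast
qed

end
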